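(* Let $p\in[1,\infty)$ and let $q>p$ (with $q\in(1,\infty]$). Fix $l\in\mathbb{N}$. Then the pseudo metric space $(B(\ell^p(\mathbb{N}^l)),d_q/S_{\mathbb{N}})$ is compact.
   Context: $\ell^p(\mathbb{N}^l)$ is the space of functions $x:\mathbb{N}^l\to\mathbb{C}$ with $\|x\|_p=(\sum|x(i)|^p)^{1/p}<\infty$, and $B(\ell^p(\mathbb{N}^l))$ its closed unit ball (contained in $\ell^q(\mathbb{N}^l)$). $d_q(x,y)=\|x-y\|_q$. $S_{\mathbb{N}}$ is the group of bijections $\tau:\mathbb{N}\to\mathbb{N}$, acting on $\mathbb{N}^l$ coordinatewise and on functions by $(\tau x)(i_1,\dots,i_l)=x(\tau^{-1}i_1,\dots,\tau^{-1}i_l)$; $(d_q/S_{\mathbb{N}})(x,y):=\inf_{\tau\in S_{\mathbb{N}}}d_q(x,\tau y)$. *)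

theory Defs
  imports "HOL-Analysis.Analysis"
begin

text \<open>As the library's locale \<^locale>\<open>Metric_space\<close>, except that distinct points may have
  distance 0 and that all axioms are relative to the carrier.\<close>

locale pseudometric_space =
  fixes M :: "'a set" and d :: "'a \<Rightarrow> 'a \<Rightarrow> real"
  assumes nonneg: "\<lbrakk>x \<in> M; y \<in> M\<rbrakk> \<Longrightarrow> 0 \<le> d x y"
    and self: "x \<in> M \<Longrightarrow> d x x = 0"
    and commute: "\<lbrakk>x \<in> M; y \<in> M\<rbrakk> \<Longrightarrow> d x y = d y x"
    and triangle: "\<lbrakk>x \<in> M; y \<in> M; z \<in> M\<rbrakk> \<Longrightarrow> d x z \<le> d x y + d y z"

definition pseudometric_topology :: "'a set \<Rightarrow> ('a \<Rightarrow> 'a \<Rightarrow> real) \<Rightarrow> 'a topology" where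
  "pseudometric_topology M d =
     topology (\<lambda>U. U \<subseteq> M \<and> (\<forall>x\<in>U. \<exists>r>0. {y \<in> M. d x y < r} \<subseteq> U))"

lemma openin_pseudometric_topology:
  "openin (pseudometric_topology M d) U \<longleftrightarrow>
     U \<subseteq> M \<and> (\<forall>x\<in>U. \<exists>r>0. {y \<in> M. d x y < r} \<subseteq> U)"
proof -
  let ?P = "\<lambda>U. U \<subseteq> M \<and> (\<forall>x\<in>U. \<exists>r>0. {y \<in> M. d x y < r} \<subseteq> U)"
  have "?P (S \<inter> T)" if S: "?P S" and T: "?P T" for S T
  proof (intro conjI ballI)
    show "S \<inter> T \<subseteq> M" using S by blast
    fix x assume x: "x \<in> S \<inter> T"
    obtain r where r: "r > 0" "{y \<in> M. d x y < r} \<subseteq> S" using S x by blast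
    obtain s where s: "s > 0" "{y \<in> M. d x y < s} \<subseteq> T" using T x by blast
    show "\<exists>r>0. {y \<in> M. d x y < r} \<subseteq> S \<inter> T"
      using r s by (intro exI[of _ "min r s"]) auto
  qed
  moreover have "?P (\<Union>\<K>)" if "\<forall>K\<in>\<K>. ?P K" for \<K>
  proof (intro conjI ballI)
    show "\<Union>\<K> \<subseteq> M" using that by blast
    fix x assume "x \<in> \<Union>\<K>"
    then obtain K where K: "K \<in> \<K>" "x \<in> K" by blast
    then have "\<exists>r>0. {y \<in> M. d x y < r} \<subseteq> K" using that by metis
    then show "\<exists>r>0. {y \<in> M. d x y < r} \<subseteq> \<Union>\<K>"
      using Union_upper[OF K(1)] by (meson subset_trans)
  qed
  ultimately have "istopology ?P"
    unfolding istopology_def by simp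
  then show ?thesis
    by (simp add: pseudometric_topology_def)
qed

lemma topspace_pseudometric_topology [simp]: "topspace (pseudometric_topology M d) = M"
proof -
  have "openin (pseudometric_topology M d) M"
    by (auto simp: openin_pseudometric_topology intro: zero_less_one)
  then show ?thesis
    by (meson openin_pseudometric_topology openin_subset openin_topspace subset_antisym)
qed

definition tuples :: "nat \<Rightarrow> nat list set" where
  "tuples l = {i. length i = l}"

text \<open>A function on \<open>\<nat>\<^sup>l\<close> is represented by a function on lists that is
  \<^const>\<open>undefined\<close> outside \<^term>\<open>tuples l\<close>, so that distinct representatives are distinct
  functions on \<open>\<nat>\<^sup>l\<close>. The exponent ranges over \<^typ>\<open>ereal\<close> in order to include \<open>p = \<infinity>\<close>.\<close>

definition lp_space :: "ereal \<Rightarrow> nat \<Rightarrow> (nat list \<Rightarrow> complex) set" where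
  "lp_space p l = {x \<in> extensional (tuples l).
     if p = \<infinity> then bdd_above ((\<lambda>i. cmod (x i)) ` tuples l)
     else (\<lambda>i. cmod (x i) powr real_of_ereal p) summable_on tuples l}"

text \<open>Only values on \<^term>\<open>tuples l\<close> enter the norm. It is meaningful on \<^const>\<open>lp_space\<close> only:
  elsewhere the sum or supremum takes a default value.\<close>

definition lp_norm :: "ereal \<Rightarrow> nat \<Rightarrow> (nat list \<Rightarrow> complex) \<Rightarrow> real" where
  "lp_norm p l x =
     (if p = \<infinity> then (SUP i\<in>tuples l. cmod (x i))
      else (\<Sum>\<^sub>\<infinity>i\<in>tuples l. cmod (x i) powr real_of_ereal p) powr (1 / real_of_ereal p))"

definition lp_ball :: "ereal \<Rightarrow> nat \<Rightarrow> (nat list \<Rightarrow> complex) set" where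
  "lp_ball p l = {x \<in> lp_space p l. lp_norm p l x \<le> 1}"

definition lp_dist :: "ereal \<Rightarrow> nat \<Rightarrow> (nat list \<Rightarrow> complex) \<Rightarrow> (nat list \<Rightarrow> complex) \<Rightarrow> real" where
  "lp_dist q l x y = lp_norm q l (\<lambda>i. x i - y i)"

definition perm_act ::
    "nat \<Rightarrow> (nat \<Rightarrow> nat) \<Rightarrow> (nat list \<Rightarrow> complex) \<Rightarrow> (nat list \<Rightarrow> complex)" where
  "perm_act l \<tau> x = (\<lambda>i\<in>tuples l. x (map (inv \<tau>) i))"

definition orbit_dist ::
    "ereal \<Rightarrow> nat \<Rightarrow> (nat list \<Rightarrow> complex) \<Rightarrow> (nat list \<Rightarrow> complex) \<Rightarrow> real" where
  "orbit_dist q l x y = (INF \<tau>\<in>{\<tau>. bij \<tau>}. lp_dist q l x (perm_act l \<tau> y))"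

end

theory Submission
  imports Defs
begin

text \<open>An element of the unit ball of \<open>\<ell>\<^sup>p\<close> has boundedly many entries of modulus greater than
  \<open>e\<close>, so a permutation of \<open>\<nat>\<close> moves all of them into a fixed finite box. Rounding the entries in
  that box to multiples of \<open>e\<close> sorts the ball into finitely many classes; two permuted elements in
  the same class differ by at most \<open>2 e\<close> in every entry and by at most \<open>2\<close> in \<open>\<ell>\<^sup>p\<close>, hence by
  interpolation by little in \<open>\<ell>\<^sup>q\<close>. This is total boundedness. For completeness, a sequence with
  geometrically decreasing orbit distances is permuted, step by step, into a Cauchy sequence in
  \<open>\<ell>\<^sup>q\<close>, whose pointwise limit stays in the ball by Fatou's lemma.\<close>

section \<open>Minkowski's inequality for finite sums\<close>

text \<open>Convexity of \<open>u powr r\<close> at \<open>(s + t) / (a + b)\<close>, which is the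
  mean of \<open>s / a\<close> and \<open>t / b\<close> with weights \<open>a / (a + b)\<close> and
  \<open>b / (a + b)\<close>. Summed over the entries it gives Minkowski's inequality
  directly.\<close>

lemma Minkowski_pointwise:
  fixes a b r s t :: real
  assumes r: "1 \<le> r" and ab: "0 < a" "0 < b" and st: "0 \<le> s" "0 \<le> t"
  shows "(s + t) powr r
    \<le> (a + b) powr r * (a / (a + b) * (s powr r / a powr r) + b / (a + b) * (t powr r / b powr r))"
proof -
  \<comment> \<open>Convexity is applied to positive points. If \<open>s\<close> or \<open>t\<close>
    is zero, at most one term of the mean remains, and its weight \<open>w\<close> satisfies
    \<open>w powr r \<le> w\<close>.\<close>
  have one: "u powr r \<le> u" if "0 \<le> u" "u \<le> 1" for u :: real
    using powr_mono'[of 1 r u] r that by simp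
  let ?u = "b / (a + b)"
  have u: "0 \<le> ?u" "?u \<le> 1" "1 - ?u = a / (a + b)"
    using ab by (auto simp: field_simps)
  have v: "0 \<le> a / (a + b)" "a / (a + b) \<le> 1"
    using ab by (auto simp: field_simps)
  have conv: "((1 - ?u) * (s / a) + ?u * (t / b)) powr r
      \<le> (1 - ?u) * (s / a) powr r + ?u * (t / b) powr r"
  proof (cases "s = 0 \<or> t = 0")
    case False
    then show ?thesis
      using convex_onD[OF powr_convex[OF r], of ?u "s / a" "t / b"] u ab st by simp
  next
    case True
    have "(?u * (t / b)) powr r \<le> ?u * (t / b) powr r"
      using mult_right_mono[OF one[of ?u], of "(t / b) powr r"] u ab st by (subst powr_mult) auto
    moreover have "(a / (a + b) * (s / a)) powr r \<le> a / (a + b) * (s / a) powr r"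
      using mult_right_mono[OF one[of "a / (a + b)"], of "(s / a) powr r"] v ab st
      by (subst powr_mult) auto
    ultimately show ?thesis
      using True r unfolding u(3) by auto
  qed
  have "(s + t) powr r = ((a + b) * ((1 - ?u) * (s / a) + ?u * (t / b))) powr r"
    unfolding u(3) using ab by (simp add: distrib_left)
  also have "\<dots> = (a + b) powr r * ((1 - ?u) * (s / a) + ?u * (t / b)) powr r"
    using ab st u by (intro powr_mult)
  also have "\<dots> \<le> (a + b) powr r * ((1 - ?u) * (s / a) powr r + ?u * (t / b) powr r)"
    by (intro mult_left_mono conv) simp
  finally show ?thesis
    unfolding u(3) using ab st by (simp add: powr_divide)
qed

text \<open>The weights of the pointwise bound add up to 1. Since \<open>a\<close> and
  \<open>b\<close> only bound the norms from above, they can be positive even where a norm is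
  zero.\<close>

lemma finite_sum_Minkowski:
  fixes f g :: "'a \<Rightarrow> real" and a b r :: real
  assumes r: "1 \<le> r" and ab: "0 < a" "0 < b"
    and nn: "\<And>i. i \<in> G \<Longrightarrow> 0 \<le> f i" "\<And>i. i \<in> G \<Longrightarrow> 0 \<le> g i"
    and f: "(\<Sum>i\<in>G. f i powr r) \<le> a powr r" and g: "(\<Sum>i\<in>G. g i powr r) \<le> b powr r"
  shows "(\<Sum>i\<in>G. (f i + g i) powr r) \<le> (a + b) powr r"
proof -
  have "(\<Sum>i\<in>G. (f i + g i) powr r) \<le> (\<Sum>i\<in>G. (a + b) powr r *
      (a / (a + b) * (f i powr r / a powr r) + b / (a + b) * (g i powr r / b powr r)))"
    using Minkowski_pointwise[OF r ab] nn by (intro sum_mono) auto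
  also have "\<dots> = (a + b) powr r * (a / (a + b) * ((\<Sum>i\<in>G. f i powr r) / a powr r)
      + b / (a + b) * ((\<Sum>i\<in>G. g i powr r) / b powr r))"
    by (simp only: sum_divide_distrib sum_distrib_left sum.distrib[symmetric])
  also have "\<dots> \<le> (a + b) powr r * (a / (a + b) * 1 + b / (a + b) * 1)"
    using ab f g by (intro mult_left_mono add_mono) auto
  also have "\<dots> = (a + b) powr r"
    using ab by (simp flip: add_divide_distrib)
  finally show ?thesis .
qed

section \<open>Norm bounds through finite partial sums\<close>

text \<open>The relation \<open>\<parallel>x\<parallel>\<^sub>q \<le> c\<close>, expressed by finite partial sums so that it is meaningful for
  every \<open>x\<close>, in particular for differences, which are not extensional.\<close>

definition lp_bounded :: "ereal \<Rightarrow> nat \<Rightarrow> real \<Rightarrow> (nat list \<Rightarrow> complex) \<Rightarrow> bool" where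
  "lp_bounded q l c x \<longleftrightarrow>
     (if q = \<infinity> then \<forall>i\<in>tuples l. cmod (x i) \<le> c
      else \<forall>G. finite G \<and> G \<subseteq> tuples l \<longrightarrow>
        (\<Sum>i\<in>G. cmod (x i) powr real_of_ereal q) \<le> c powr real_of_ereal q)"

lemma lp_bounded_infinity: "lp_bounded \<infinity> l c x \<longleftrightarrow> (\<forall>i\<in>tuples l. cmod (x i) \<le> c)"
  by (simp add: lp_bounded_def)

lemma lp_bounded_ereal: "lp_bounded (ereal r) l c x \<longleftrightarrow>
    (\<forall>G. finite G \<and> G \<subseteq> tuples l \<longrightarrow> (\<Sum>i\<in>G. cmod (x i) powr r) \<le> c powr r)"
  by (simp add: lp_bounded_def)

lemma one_le_ereal_exponent:
  assumes "1 \<le> p" "ereal p \<le> q"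
  shows "1 \<le> q"
  using assms by (metis ereal_less_eq(3) one_ereal_def order_trans)

lemma ereal_ge_one_cases:
  fixes q :: ereal
  assumes "1 \<le> q"
  obtains "q = \<infinity>" | r where "q = ereal r" "1 \<le> r"
  using assms by (cases q) auto

lemma tuples_nonempty: "tuples l \<noteq> {}"
proof -
  have "replicate l 0 \<in> tuples l"
    by (simp add: tuples_def)
  then show ?thesis by blast
qed

lemma lp_bounded_cong:
  assumes "\<And>i. i \<in> tuples l \<Longrightarrow> cmod (x i) = cmod (y i)"
  shows "lp_bounded q l c x = lp_bounded q l c y"
proof -
  have "(\<Sum>i\<in>G. cmod (x i) powr s) = (\<Sum>i\<in>G. cmod (y i) powr s)" if "G \<subseteq> tuples l" for G s
    using that assms by (intro sum.cong) auto
  then show ?thesis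
    unfolding lp_bounded_def using assms by auto
qed

lemma lp_bounded_mono:
  assumes "1 \<le> q" "0 \<le> c" "c \<le> d" "lp_bounded q l c x"
  shows "lp_bounded q l d x"
  using assms(1)
proof (cases rule: ereal_ge_one_cases)
  case 1
  then show ?thesis
    using assms by (force simp: lp_bounded_infinity)
next
  case (2 r)
  have "c powr r \<le> d powr r"
    using 2 assms by (intro powr_mono2) auto
  then show ?thesis
    using 2 assms(4) by (force simp: lp_bounded_ereal)
qed

lemma lp_bounded_pointwise:
  assumes "1 \<le> q" "0 \<le> c" "lp_bounded q l c x" "i \<in> tuples l"
  shows "cmod (x i) \<le> c"
  using assms(1)
proof (cases rule: ereal_ge_one_cases)
  case 1
  then show ?thesis
    using assms by (simp add: lp_bounded_infinity)
next
  case (2 r)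
  have "(\<Sum>i\<in>{i}. cmod (x i) powr r) \<le> c powr r"
    using 2 assms(3,4) unfolding \<open>q = ereal r\<close> lp_bounded_ereal by blast
  then show ?thesis
    using 2 assms powr_less_mono2[of r c "cmod (x i)"] by force
qed

lemma lp_bounded_add:
  assumes q: "1 \<le> q" and ab: "0 < a" "0 < b"
    and x: "lp_bounded q l a x" and y: "lp_bounded q l b y"
  shows "lp_bounded q l (a + b) (\<lambda>i. x i + y i)"
  using q
proof (cases rule: ereal_ge_one_cases)
  case 1
  then show ?thesis
    using x y by (auto simp: lp_bounded_infinity intro!: order_trans[OF norm_triangle_ineq] add_mono)
next
  case (2 r)
  have "(\<Sum>i\<in>G. cmod (x i + y i) powr r) \<le> (a + b) powr r" if G: "finite G" "G \<subseteq> tuples l" for G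
  proof -
    have "(\<Sum>i\<in>G. cmod (x i + y i) powr r) \<le> (\<Sum>i\<in>G. (cmod (x i) + cmod (y i)) powr r)"
      using 2 by (intro sum_mono powr_mono2 norm_triangle_ineq) auto
    also have "\<dots> \<le> (a + b) powr r"
      using 2 ab x y G by (intro finite_sum_Minkowski) (auto simp: lp_bounded_ereal)
    finally show ?thesis .
  qed
  then show ?thesis
    using 2 by (simp add: lp_bounded_ereal)
qed

lemma lp_bounded_minus_commute: "lp_bounded q l c (\<lambda>i. x i - y i) = lp_bounded q l c (\<lambda>i. y i - x i)"
  by (rule lp_bounded_cong) (rule norm_minus_commute)

lemma lp_bounded_diff:
  assumes "1 \<le> q" "0 < a" "0 < b" "lp_bounded q l a x" "lp_bounded q l b y"
  shows "lp_bounded q l (a + b) (\<lambda>i. x i - y i)"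
proof -
  have "lp_bounded q l b (\<lambda>i. - y i)"
    using assms(5) lp_bounded_cong[of l y "\<lambda>i. - y i"] by simp
  then show ?thesis
    using lp_bounded_add[OF assms(1-4)] by fastforce
qed

text \<open>As \<open>map \<sigma>\<close> is injective, each finite partial sum of the composite is
  a finite partial sum of \<open>x\<close>.\<close>

lemma lp_bounded_comp_map:
  assumes "inj \<sigma>" "lp_bounded q l c x"
  shows "lp_bounded q l c (\<lambda>i. x (map \<sigma> i))"
proof -
  have "(\<Sum>i\<in>G. cmod (x (map \<sigma> i)) powr s) = (\<Sum>i\<in>map \<sigma> ` G. cmod (x i) powr s)" for G s
    using assms(1) by (subst sum.reindex) (auto intro: inj_on_subset)
  moreover have "finite (map \<sigma> ` G) \<and> map \<sigma> ` G \<subseteq> tuples l" if "finite G" "G \<subseteq> tuples l" for G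
    using that by (auto simp: tuples_def)
  moreover have "map \<sigma> i \<in> tuples l" if "i \<in> tuples l" for i
    using that by (simp add: tuples_def)
  ultimately show ?thesis
    using assms(2) unfolding lp_bounded_def by (auto split: if_splits)
qed

text \<open>A form of Fatou's lemma: a finite partial sum depends continuously on its entries, so
  its bound passes to the pointwise limit.\<close>

lemma lp_bounded_limit:
  assumes q: "1 \<le> q" and lim: "\<And>i. i \<in> tuples l \<Longrightarrow> (\<lambda>n. x n i) \<longlonglongrightarrow> y i"
    and bd: "\<And>n. N \<le> n \<Longrightarrow> lp_bounded q l c (x n)"
  shows "lp_bounded q l c y"
  using q
proof (cases rule: ereal_ge_one_cases)
  case 1
  have "cmod (y i) \<le> c" if i: "i \<in> tuples l" for i
    using bd i 1
    by (intro LIMSEQ_le_const2[OF tendsto_norm[OF lim[OF i]]] exI[of _ N])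
       (auto simp: lp_bounded_infinity)
  then show ?thesis
    using 1 by (simp add: lp_bounded_infinity)
next
  case (2 r)
  have "(\<Sum>i\<in>G. cmod (y i) powr r) \<le> c powr r" if G: "finite G" "G \<subseteq> tuples l" for G
  proof (rule LIMSEQ_le_const2)
    show "(\<lambda>n. \<Sum>i\<in>G. cmod (x n i) powr r) \<longlonglongrightarrow> (\<Sum>i\<in>G. cmod (y i) powr r)"
      using G 2 lim by (intro tendsto_intros tendsto_powr2) auto
    show "\<exists>N. \<forall>n\<ge>N. (\<Sum>i\<in>G. cmod (x n i) powr r) \<le> c powr r"
      using bd G 2 by (auto simp: lp_bounded_ereal)
  qed
  then show ?thesis
    using 2 by (simp add: lp_bounded_ereal)
qed

section \<open>Interpolation between exponents\<close>

text \<open>In \<open>|u|^r = |u|^(r - p) * |u|^p\<close> the first factor is bounded uniformly and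
  the second is summed.\<close>

lemma lp_bounded_interpolate:
  assumes pr: "0 < p" "p \<le> r" and u: "lp_bounded (ereal p) l c u"
    and e: "0 \<le> e" "\<And>i. i \<in> tuples l \<Longrightarrow> cmod (u i) \<le> e" and G: "finite G" "G \<subseteq> tuples l"
  shows "(\<Sum>i\<in>G. cmod (u i) powr r) \<le> e powr (r - p) * c powr p"
proof -
  \<comment> \<open>True also at zero entries, because \<open>0 powr s = 0\<close> for every
    \<open>s\<close>, zero included.\<close>
  have "(\<Sum>i\<in>G. cmod (u i) powr r) = (\<Sum>i\<in>G. cmod (u i) powr (r - p) * cmod (u i) powr p)"
    by (simp flip: powr_add)
  also have "\<dots> \<le> (\<Sum>i\<in>G. e powr (r - p) * cmod (u i) powr p)"
    using pr e G by (intro sum_mono mult_right_mono powr_mono2) auto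
  also have "\<dots> = e powr (r - p) * (\<Sum>i\<in>G. cmod (u i) powr p)"
    by (simp add: sum_distrib_left)
  also have "\<dots> \<le> e powr (r - p) * c powr p"
    using u G by (intro mult_left_mono) (auto simp: lp_bounded_ereal)
  finally show ?thesis .
qed

text \<open>Powers of numbers in [0, 1] do not grow with the exponent: interpolation with
  \<open>e = 1\<close>.\<close>

lemma lp_bounded_one_embed:
  assumes p: "1 \<le> p" "ereal p \<le> q" and u: "lp_bounded (ereal p) l 1 u"
  shows "lp_bounded q l 1 u"
proof -
  have u1: "cmod (u i) \<le> 1" if "i \<in> tuples l" for i
    using lp_bounded_pointwise[OF _ _ u that] p by simp
  have "1 \<le> q"
    using p by (rule one_le_ereal_exponent)
  then show ?thesis
  proof (cases rule: ereal_ge_one_cases)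
    case 1
    then show ?thesis
      using u1 by (simp add: lp_bounded_infinity)
  next
    case (2 r)
    then show ?thesis
      using lp_bounded_interpolate[of p r l 1 u 1] p u u1 by (simp add: lp_bounded_ereal)
  qed
qed

text \<open>The strict inequality makes \<open>r - p\<close> positive, so the factor
  \<open>e powr (r - p)\<close> tends to 0 with \<open>e\<close>. For \<open>q = \<infinity>\<close>
  the entries alone decide and \<open>e = d\<close> serves.\<close>

lemma lp_bounded_small:
  assumes p: "1 \<le> p" "ereal p < q" and d: "0 < d" and c: "0 < c"
  obtains e where "0 < e"
    "\<And>u. \<lbrakk>lp_bounded (ereal p) l c u; \<And>i. i \<in> tuples l \<Longrightarrow> cmod (u i) \<le> e\<rbrakk> \<Longrightarrow> lp_bounded q l d u"
proof -
  have "1 \<le> q"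
    using p by (simp add: one_le_ereal_exponent)
  then show thesis
  proof (cases rule: ereal_ge_one_cases)
    case 1
    then show ?thesis
      using d that[of d] by (simp add: lp_bounded_infinity)
  next
    case (2 r)
    then have pr: "p < r"
      using p by simp
    \<comment> \<open>The solution of \<open>e powr (r - p) * c powr p = d powr r\<close>.\<close>
    define e where "e = (d powr r / c powr p) powr (1 / (r - p))"
    have e: "0 < e" "e powr (r - p) * c powr p = d powr r"
      using pr d c by (auto simp: e_def powr_powr)
    show ?thesis
      using lp_bounded_interpolate[of p r l c _ e] p pr e
      by (intro that[of e]) (auto simp: lp_bounded_ereal \<open>q = ereal r\<close>)
  qed
qed

section \<open>Norm bounds compared with the norm and the unit ball\<close>

lemma lp_bounded_imp_norm_le:
  assumes q: "1 \<le> q" and c: "0 \<le> c" and x: "lp_bounded q l c x"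
  shows "lp_norm q l x \<le> c"
  using q
proof (cases rule: ereal_ge_one_cases)
  case 1
  then show ?thesis
    using x tuples_nonempty by (auto simp: lp_norm_def lp_bounded_infinity intro!: cSUP_least)
next
  case (2 r)
  have le: "(\<Sum>\<^sub>\<infinity>i\<in>tuples l. cmod (x i) powr r) \<le> c powr r"
  proof (rule infsum_le_finite_sums)
    show "(\<lambda>i. cmod (x i) powr r) summable_on tuples l"
      using x 2 by (intro nonneg_bdd_above_summable_on bdd_aboveI2[where M = "c powr r"])
        (auto simp: lp_bounded_ereal)
  qed (use x 2 in \<open>auto simp: lp_bounded_ereal\<close>)
  have "(\<Sum>\<^sub>\<infinity>i\<in>tuples l. cmod (x i) powr r) powr (1 / r) \<le> (c powr r) powr (1 / r)"
    using le 2 by (intro powr_mono2 infsum_nonneg) auto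
  then show ?thesis
    using 2 c by (simp add: lp_norm_def powr_powr)
qed

text \<open>Having some bound \<open>c\<close> makes the sum converge, or the supremum exist, so
  \<open>lp_norm\<close> is no default value. With the preceding lemma, the norm is the least
  nonnegative bound.\<close>

lemma lp_bounded_lp_norm:
  assumes q: "1 \<le> q" and x: "lp_bounded q l c x"
  shows "0 \<le> lp_norm q l x" "lp_bounded q l (lp_norm q l x) x"
proof -
  have "0 \<le> lp_norm q l x \<and> lp_bounded q l (lp_norm q l x) x"
    using q
  proof (cases rule: ereal_ge_one_cases)
    case 1
    obtain j where j: "j \<in> tuples l"
      using tuples_nonempty by blast
    have le: "cmod (x i) \<le> lp_norm q l x" if "i \<in> tuples l" for i
      using that x 1 by (auto simp: lp_norm_def lp_bounded_infinity intro!: cSUP_upper bdd_aboveI2)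
    then show ?thesis
      using 1 order_trans[OF norm_ge_zero le[OF j]] by (simp add: lp_bounded_infinity)
  next
    case (2 r)
    have sm: "(\<lambda>i. cmod (x i) powr r) summable_on tuples l"
      using x 2 by (intro nonneg_bdd_above_summable_on bdd_aboveI2[where M = "c powr r"])
        (auto simp: lp_bounded_ereal)
    have "lp_norm q l x powr r = (\<Sum>\<^sub>\<infinity>i\<in>tuples l. cmod (x i) powr r)"
      using 2 by (simp add: lp_norm_def powr_powr infsum_nonneg)
    then show ?thesis
      using 2 sm by (auto simp: lp_bounded_ereal lp_norm_def intro!: finite_sum_le_infsum)
  qed
  then show "0 \<le> lp_norm q l x" "lp_bounded q l (lp_norm q l x) x"
    by auto
qed

text \<open>For nonnegative terms, bounded finite partial sums give summability and bound the total.
  This lets the ball be handled through partial sums alone.\<close>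

lemma lp_ball_iff:
  assumes p: "1 \<le> p"
  shows "x \<in> lp_ball (ereal p) l \<longleftrightarrow> x \<in> extensional (tuples l) \<and> lp_bounded (ereal p) l 1 x"
proof
  assume x: "x \<in> lp_ball (ereal p) l"
  then have sm: "(\<lambda>i. cmod (x i) powr p) summable_on tuples l"
    and nx: "lp_norm (ereal p) l x \<le> 1" and ext: "x \<in> extensional (tuples l)"
    by (auto simp: lp_ball_def lp_space_def)
  have "lp_norm (ereal p) l x powr p = (\<Sum>\<^sub>\<infinity>i\<in>tuples l. cmod (x i) powr p)"
    using p by (simp add: lp_norm_def powr_powr infsum_nonneg)
  moreover have "lp_norm (ereal p) l x powr p \<le> 1 powr p"
    using p nx by (intro powr_mono2) (auto simp: lp_norm_def)
  ultimately have "(\<Sum>\<^sub>\<infinity>i\<in>tuples l. cmod (x i) powr p) \<le> 1"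
    by simp
  then show "x \<in> extensional (tuples l) \<and> lp_bounded (ereal p) l 1 x"
    using ext order_trans[OF finite_sum_le_infsum[OF sm]] by (auto simp: lp_bounded_ereal)
next
  assume x: "x \<in> extensional (tuples l) \<and> lp_bounded (ereal p) l 1 x"
  have "(\<lambda>i. cmod (x i) powr p) summable_on tuples l"
    using x by (intro nonneg_bdd_above_summable_on bdd_aboveI2[where M = 1])
      (auto simp: lp_bounded_ereal)
  then show "x \<in> lp_ball (ereal p) l"
    using x p lp_bounded_imp_norm_le[of "ereal p" 1 l x] by (simp add: lp_ball_def lp_space_def)
qed

section \<open>The action of permutations\<close>

lemma map_mem_tuples [simp]: "map f i \<in> tuples l \<longleftrightarrow> i \<in> tuples l"
  by (simp add: tuples_def)

lemma perm_act_apply: "i \<in> tuples l \<Longrightarrow> perm_act l \<tau> x i = x (map (inv \<tau>) i)"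
  by (simp add: perm_act_def)

text \<open>Acting on the argument reverses the order of composition and so does \<open>inv\<close>;
  together they give a left action.\<close>

lemma perm_act_comp:
  assumes "bij \<sigma>" "bij \<tau>"
  shows "perm_act l \<sigma> (perm_act l \<tau> x) = perm_act l (\<sigma> \<circ> \<tau>) x"
  unfolding perm_act_def using assms
  by (auto simp: o_inv_distrib fun_eq_iff restrict_def)

lemma perm_act_id: "x \<in> extensional (tuples l) \<Longrightarrow> perm_act l id x = x"
  by (auto simp: perm_act_def fun_eq_iff extensional_def)

lemma lp_bounded_perm_act:
  assumes "bij \<sigma>" "lp_bounded q l c x"
  shows "lp_bounded q l c (perm_act l \<sigma> x)"
proof -
  have "lp_bounded q l c (\<lambda>i. x (map (inv \<sigma>) i))"
    using assms by (intro lp_bounded_comp_map) (auto simp: bij_imp_bij_inv bij_is_inj)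
  then show ?thesis
    using lp_bounded_cong[of l "perm_act l \<sigma> x"] by (simp add: perm_act_apply)
qed

text \<open>Permutations act by isometries. Symmetry and the triangle inequality for orbit distances
  rest on this.\<close>

lemma lp_bounded_perm_act_diff:
  assumes "bij \<sigma>" "lp_bounded q l c (\<lambda>i. x i - y i)"
  shows "lp_bounded q l c (\<lambda>i. perm_act l \<sigma> x i - perm_act l \<sigma> y i)"
proof -
  have "lp_bounded q l c (perm_act l \<sigma> (\<lambda>i. x i - y i))"
    using lp_bounded_perm_act[OF assms] .
  then show ?thesis
    using lp_bounded_cong[of l "perm_act l \<sigma> (\<lambda>i. x i - y i)"
        "\<lambda>i. perm_act l \<sigma> x i - perm_act l \<sigma> y i"]
    by (simp add: perm_act_apply)
qed

lemma perm_act_mem_lp_ball: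
  assumes "1 \<le> p" "bij \<sigma>" "x \<in> lp_ball (ereal p) l"
  shows "perm_act l \<sigma> x \<in> lp_ball (ereal p) l"
  using assms lp_bounded_perm_act[of \<sigma> "ereal p" l 1 x]
  by (auto simp: lp_ball_iff) (simp add: perm_act_def)

lemma lp_ball_diff_lp_bounded:
  assumes p: "1 \<le> p" "ereal p \<le> q" and xy: "x \<in> lp_ball (ereal p) l" "y \<in> lp_ball (ereal p) l"
  shows "lp_bounded q l 2 (\<lambda>i. x i - y i)"
proof -
  have "1 \<le> q"
    using p by (rule one_le_ereal_exponent)
  moreover have "lp_bounded q l 1 x" "lp_bounded q l 1 y"
    using p xy by (auto simp: lp_ball_iff intro: lp_bounded_one_embed)
  ultimately show ?thesis
    using lp_bounded_diff[of q 1 1 l x y] by simp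
qed

section \<open>The orbit pseudometric\<close>

text \<open>The infimum need not be attained, hence the strict inequality. The witness
  \<open>c\<close> is positive because \<open>lp_bounded_add\<close> takes positive bounds.\<close>

lemma orbit_dist_less_iff:
  assumes p: "1 \<le> p" "ereal p \<le> q" and xy: "x \<in> lp_ball (ereal p) l" "y \<in> lp_ball (ereal p) l"
  shows "orbit_dist q l x y < r \<longleftrightarrow>
    (\<exists>\<tau> c. bij \<tau> \<and> 0 < c \<and> c < r \<and> lp_bounded q l c (\<lambda>i. x i - perm_act l \<tau> y i))"
proof -
  have q: "1 \<le> q"
    using p by (rule one_le_ereal_exponent)
  have bd: "lp_bounded q l 2 (\<lambda>i. x i - perm_act l \<tau> y i)" if "bij \<tau>" for \<tau>
    using p xy that by (intro lp_ball_diff_lp_bounded perm_act_mem_lp_ball)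
  \<comment> \<open>A real infimum is meaningful only over a nonempty set that is bounded
    below.\<close>
  have "bdd_below ((\<lambda>\<tau>. lp_dist q l x (perm_act l \<tau> y)) ` {\<tau>. bij \<tau>})"
    using lp_bounded_lp_norm(1)[OF q bd] by (intro bdd_belowI2[where m = 0]) (auto simp: lp_dist_def)
  moreover have "{\<tau> :: nat \<Rightarrow> nat. bij \<tau>} \<noteq> {}"
    using bij_id by blast
  ultimately have "orbit_dist q l x y < r \<longleftrightarrow> (\<exists>\<tau>. bij \<tau> \<and> lp_dist q l x (perm_act l \<tau> y) < r)"
    by (simp add: orbit_dist_def cINF_less_iff)
  also have "\<dots> \<longleftrightarrow>
    (\<exists>\<tau> c. bij \<tau> \<and> 0 < c \<and> c < r \<and> lp_bounded q l c (\<lambda>i. x i - perm_act l \<tau> y i))"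
  proof (rule ex_cong1)
    fix \<tau>
    let ?u = "\<lambda>i. x i - perm_act l \<tau> y i"
    show "bij \<tau> \<and> lp_dist q l x (perm_act l \<tau> y) < r \<longleftrightarrow>
      (\<exists>c. bij \<tau> \<and> 0 < c \<and> c < r \<and> lp_bounded q l c ?u)"
    proof safe
      assume \<tau>: "bij \<tau>" and less: "lp_dist q l x (perm_act l \<tau> y) < r"
      note N = lp_bounded_lp_norm[OF q bd[OF \<tau>]]
      have "lp_norm q l ?u < r"
        using less by (simp add: lp_dist_def)
      \<comment> \<open>Strictly above the norm, \<open>c\<close> is positive even if the norm is
        0.\<close>
      then obtain c where c: "lp_norm q l ?u < c" "c < r"
        using dense by blast
      then show "\<exists>c. bij \<tau> \<and> 0 < c \<and> c < r \<and> lp_bounded q l c ?u"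
        using lp_bounded_mono[OF q N(1) _ N(2), of c] N(1) \<tau> by (intro exI[of _ c]) auto
    next
      fix c assume "0 < c" "c < r" "lp_bounded q l c ?u"
      then show "lp_dist q l x (perm_act l \<tau> y) < r"
        using lp_bounded_imp_norm_le[OF q, of c l ?u] by (simp add: lp_dist_def)
    qed
  qed
  finally show ?thesis .
qed

lemma orbit_dist_pseudometric:
  assumes p: "1 \<le> p" "ereal p \<le> q"
  shows "pseudometric_space (lp_ball (ereal p) l) (orbit_dist q l)"
proof -
  let ?M = "lp_ball (ereal p) l"
  have q: "1 \<le> q"
    using p by (rule one_le_ereal_exponent)
  note iff = orbit_dist_less_iff[OF p]
  \<comment> \<open>At \<open>r = 0\<close> the witness would satisfy
    \<open>0 < c < 0\<close>.\<close>
  have nonneg: "0 \<le> orbit_dist q l x y" if "x \<in> ?M" "y \<in> ?M" for x y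
    using iff[OF that, of 0] by auto
  \<comment> \<open>Applying \<open>inv \<tau>\<close> to both arguments moves the permutation to
    the other one.\<close>
  have commute_le: "orbit_dist q l x y \<le> orbit_dist q l y x" if xy: "x \<in> ?M" "y \<in> ?M" for x y
  proof (rule dense_ge)
    fix r assume "orbit_dist q l y x < r"
    then obtain \<tau> c where \<tau>: "bij \<tau>" and c: "0 < c" "c < r"
      "lp_bounded q l c (\<lambda>i. y i - perm_act l \<tau> x i)"
      using iff xy by blast
    have inv: "bij (inv \<tau>)" "inv \<tau> \<circ> \<tau> = id"
      using \<tau> by (auto simp: bij_imp_bij_inv bij_is_inj)
    have "perm_act l (inv \<tau>) (perm_act l \<tau> x) = x"
      using \<tau> inv xy p by (simp add: perm_act_comp perm_act_id lp_ball_iff)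
    then have "lp_bounded q l c (\<lambda>i. x i - perm_act l (inv \<tau>) y i)"
      using lp_bounded_perm_act_diff[OF inv(1) c(3)] lp_bounded_minus_commute[of q l c x] by simp
    then have "orbit_dist q l x y < r"
      using iff[OF xy] inv c by blast
    then show "orbit_dist q l x y \<le> r" by simp
  qed
  show ?thesis
  proof
    fix x y assume xy: "x \<in> ?M" "y \<in> ?M"
    show "0 \<le> orbit_dist q l x y"
      using nonneg[OF xy] .
    show "orbit_dist q l x y = orbit_dist q l y x"
      using commute_le xy by (simp add: antisym)
  next
    fix x assume x: "x \<in> ?M"
    have "orbit_dist q l x x \<le> 0"
    proof (rule dense_ge)
      fix r :: real assume r: "0 < r"
      have "x \<in> extensional (tuples l)"
        using x p by (simp add: lp_ball_iff)
      then have "lp_bounded q l (r / 2) (\<lambda>i. x i - perm_act l id x i)"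
        using r by (simp add: perm_act_id lp_bounded_def)
      then show "orbit_dist q l x x \<le> r"
        using iff[OF x x, of r] r by (intro less_imp_le) (auto intro!: exI[of _ id] exI[of _ "r / 2"])
    qed
    then show "orbit_dist q l x x = 0"
      using nonneg[OF x x] by simp
  next
    fix x y z assume M: "x \<in> ?M" "y \<in> ?M" "z \<in> ?M"
    show "orbit_dist q l x z \<le> orbit_dist q l x y + orbit_dist q l y z"
    proof (rule dense_ge)
      fix r assume r: "orbit_dist q l x y + orbit_dist q l y z < r"
      \<comment> \<open>Half of the slack below \<open>r\<close>, one half for each of the two
        distances.\<close>
      define h where "h = (r - (orbit_dist q l x y + orbit_dist q l y z)) / 2"
      have h: "orbit_dist q l x y < orbit_dist q l x y + h" "orbit_dist q l y z < orbit_dist q l y z + h"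
        using r by (auto simp: h_def)
      obtain \<tau> a where \<tau>: "bij \<tau>" and a: "0 < a" "a < orbit_dist q l x y + h"
        "lp_bounded q l a (\<lambda>i. x i - perm_act l \<tau> y i)"
        using iff M h by blast
      obtain \<sigma> b where \<sigma>: "bij \<sigma>" and b: "0 < b" "b < orbit_dist q l y z + h"
        "lp_bounded q l b (\<lambda>i. y i - perm_act l \<sigma> z i)"
        using iff M h by blast
      \<comment> \<open>Moving the second difference by \<open>\<tau>\<close> makes its first term
        cancel against \<open>perm_act l \<tau> y\<close>.\<close>
      have "lp_bounded q l b (\<lambda>i. perm_act l \<tau> y i - perm_act l (\<tau> \<circ> \<sigma>) z i)"
        using lp_bounded_perm_act_diff[OF \<tau> b(3)] by (simp add: perm_act_comp[OF \<tau> \<sigma>])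
      from lp_bounded_add[OF q a(1) b(1) a(3) this]
      have "lp_bounded q l (a + b) (\<lambda>i. x i - perm_act l (\<tau> \<circ> \<sigma>) z i)"
        by simp
      moreover have "a + b < r"
        using a b by (simp add: h_def field_simps)
      moreover have "bij (\<tau> \<circ> \<sigma>)"
        using \<tau> \<sigma> by (simp add: bij_comp)
      ultimately have "orbit_dist q l x z < r"
        using iff[OF M(1,3)] a(1) b(1) by (auto intro!: exI[of _ "\<tau> \<circ> \<sigma>"] exI[of _ "a + b"])
      then show "orbit_dist q l x z \<le> r" by simp
    qed
  qed
qed

section \<open>Compactness from total boundedness and completeness\<close>

text \<open>Without a finite subcover there are balls of radius \<open>(1 / 2) ^ n\<close>, none
  finitely covered, each meeting the next. Their centres converge to some \<open>y\<close>, and a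
  cover member around \<open>y\<close> contains one of the balls. Completeness is stated for just
  such sequences of centres.\<close>

lemma compact_space_pseudometric_topology:
  assumes pm: "pseudometric_space M d"
    and net: "\<And>e. 0 < e \<Longrightarrow> \<exists>C. finite C \<and> C \<subseteq> M \<and> (\<forall>x\<in>M. \<exists>c\<in>C. d c x < e)"
    and conv: "\<And>x. \<lbrakk>range x \<subseteq> M; \<And>n. d (x n) (x (Suc n)) < 2 * (1 / 2) ^ n\<rbrakk>
      \<Longrightarrow> \<exists>y\<in>M. \<forall>n. d y (x n) \<le> 4 * (1 / 2) ^ n"
  shows "compact_space (pseudometric_topology M d)"
  unfolding compact_space_alt topspace_pseudometric_topology
proof (intro allI impI, rule ccontr)
  interpret pseudometric_space M d by (rule pm)
  fix \<U>
  assume \<U>: "Ball \<U> (openin (pseudometric_topology M d)) \<and> M \<subseteq> \<Union>\<U>"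
    and no: "\<nexists>\<F>. finite \<F> \<and> \<F> \<subseteq> \<U> \<and> M \<subseteq> \<Union>\<F>"
  define cov where "cov S \<longleftrightarrow> (\<exists>\<F>. finite \<F> \<and> \<F> \<subseteq> \<U> \<and> S \<subseteq> \<Union>\<F>)" for S
  define B where "B c n = {y \<in> M. d c y < (1 / 2) ^ n}" for c and n :: nat
  have cov_mono: "cov S" if "cov T" "S \<subseteq> T" for S T
    using that unfolding cov_def by blast
  have cov_UN: "cov (\<Union>c\<in>C. f c)" if C: "finite C" "\<forall>c\<in>C. cov (f c)" for C and f :: "'a \<Rightarrow> 'a set"
    using C
  proof induction
    case empty
    show ?case
      unfolding cov_def by (intro exI[of _ "{}"]) simp
  next
    case (insert c C)
    then obtain \<F> \<G> where "finite \<F>" "\<F> \<subseteq> \<U>" "f c \<subseteq> \<Union>\<F>"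
      "finite \<G>" "\<G> \<subseteq> \<U>" "(\<Union>c\<in>C. f c) \<subseteq> \<Union>\<G>"
      unfolding cov_def by auto
    then show ?case
      unfolding cov_def by (intro exI[of _ "\<F> \<union> \<G>"]) auto
  qed
  \<comment> \<open>Pigeonhole: the finitely many balls of a net cut \<open>S\<close> into pieces,
    and if each were finitely covered, so would be \<open>S\<close>.\<close>
  have split: "\<exists>c\<in>M. \<not> cov (S \<inter> B c n)" if S: "S \<subseteq> M" "\<not> cov S" for S n
  proof (rule ccontr)
    assume "\<not> ?thesis"
    then have *: "cov (S \<inter> B c n)" if "c \<in> M" for c
      using that by blast
    obtain C where C: "finite C" "C \<subseteq> M" "\<forall>x\<in>M. \<exists>c\<in>C. d c x < (1 / 2) ^ n"
      using net[of "(1 / 2) ^ n"] by auto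
    have "cov (\<Union>c\<in>C. S \<inter> B c n)"
      using C * by (intro cov_UN) auto
    moreover have "S \<subseteq> (\<Union>c\<in>C. S \<inter> B c n)"
      using C S by (auto simp: B_def)
    ultimately show False
      using cov_mono S by blast
  qed
  have "\<exists>x. \<forall>n. (x n \<in> M \<and> \<not> cov (B (x n) n)) \<and> d (x n) (x (Suc n)) < 2 * (1 / 2) ^ n"
  proof (rule dependent_nat_choice)
    obtain c where "c \<in> M" "\<not> cov (M \<inter> B c 0)"
      using split[of M 0] no unfolding cov_def by blast
    then show "\<exists>x. x \<in> M \<and> \<not> cov (B x 0)"
      using cov_mono by blast
  next
    fix x n assume x: "x \<in> M \<and> \<not> cov (B x n)"
    have "B x n \<subseteq> M"
      by (auto simp: B_def)
    then obtain c where c: "c \<in> M" "\<not> cov (B x n \<inter> B c (Suc n))"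
      using split x by blast
    \<comment> \<open>The empty family covers the empty set, so an uncovered set has a point. It
      links the two centres.\<close>
    have "B x n \<inter> B c (Suc n) \<noteq> {}"
    proof
      assume "B x n \<inter> B c (Suc n) = {}"
      then have "cov (B x n \<inter> B c (Suc n))"
        unfolding cov_def by (intro exI[of _ "{}"]) simp
      then show False using c by simp
    qed
    then obtain z where z: "z \<in> M" "d x z < (1 / 2) ^ n" "d c z < (1 / 2) ^ Suc n"
      by (auto simp: B_def)
    have "(1 / 2 :: real) ^ Suc n \<le> (1 / 2) ^ n"
      by simp
    then have "d x c < 2 * (1 / 2) ^ n"
      using triangle[of x z c] commute[of c z] x c z by linarith
    then show "\<exists>y. (y \<in> M \<and> \<not> cov (B y (Suc n))) \<and> d x y < 2 * (1 / 2) ^ n"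
      using c cov_mono by blast
  qed
  then obtain x where x: "\<And>n. x n \<in> M" "\<And>n. \<not> cov (B (x n) n)"
    "\<And>n. d (x n) (x (Suc n)) < 2 * (1 / 2) ^ n"
    by blast
  then obtain y where y: "y \<in> M" "\<And>n. d y (x n) \<le> 4 * (1 / 2) ^ n"
    using conv[of x] by blast
  then obtain U where U: "U \<in> \<U>" "y \<in> U" "openin (pseudometric_topology M d) U"
    using \<U> by blast
  then obtain r where r: "r > 0" "{z \<in> M. d y z < r} \<subseteq> U"
    by (auto simp: openin_pseudometric_topology)
  \<comment> \<open>Four fifths of \<open>r\<close> for the distance from \<open>y\<close> to the
    centre, one fifth for the radius.\<close>
  obtain n where n: "(1 / 2 :: real) ^ n < r / 5"
    using real_arch_pow_inv[of "r / 5" "1 / 2"] r by auto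
  have "d y z < r" if "z \<in> B (x n) n" for z
    using triangle[OF y(1) x(1), of z n] y(2)[of n] that n by (simp add: B_def)
  then have "B (x n) n \<subseteq> U"
    using r by (auto simp: B_def)
  then have "cov (B (x n) n)"
    unfolding cov_def using U by (intro exI[of _ "{U}"]) auto
  then show False
    using x(2) by blast
qed

section \<open>Completeness\<close>

lemma orbit_dist_complete:
  assumes p: "1 \<le> p" "ereal p \<le> q"
    and x: "range x \<subseteq> lp_ball (ereal p) l"
    and step: "\<And>n. orbit_dist q l (x n) (x (Suc n)) < 2 * (1 / 2) ^ n"
  shows "\<exists>y\<in>lp_ball (ereal p) l. \<forall>n. orbit_dist q l y (x n) \<le> 4 * (1 / 2) ^ n"
proof -
  let ?M = "lp_ball (ereal p) l"
  have q: "1 \<le> q"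
    using p by (rule one_le_ereal_exponent)
  have xM: "x n \<in> ?M" for n
    using x by blast
  have "\<exists>\<tau>. bij \<tau> \<and> lp_bounded q l (2 * (1 / 2) ^ n) (\<lambda>i. x n i - perm_act l \<tau> (x (Suc n)) i)" for n
    using step[of n] unfolding orbit_dist_less_iff[OF p xM xM]
    by (meson lp_bounded_mono[OF q] less_imp_le)
  then obtain \<tau> where \<tau>: "\<And>n. bij (\<tau> n)"
    "\<And>n. lp_bounded q l (2 * (1 / 2) ^ n) (\<lambda>i. x n i - perm_act l (\<tau> n) (x (Suc n)) i)"
    by metis
  \<comment> \<open>\<open>\<sigma> n\<close> is the product of \<open>\<tau> 0\<close> to
    \<open>\<tau> (n - 1)\<close>, in that order; it aligns \<open>x n\<close> with all its
    predecessors.\<close>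
  define \<sigma> where "\<sigma> = rec_nat id (\<lambda>n s. s \<circ> \<tau> n)"
  have \<sigma>_Suc: "\<sigma> (Suc n) = \<sigma> n \<circ> \<tau> n" for n
    by (simp add: \<sigma>_def)
  have \<sigma>: "bij (\<sigma> n)" for n
  proof (induction n)
    case 0
    show ?case
      using bij_id by (simp add: \<sigma>_def id_def)
  next
    case (Suc n)
    then show ?case
      unfolding \<sigma>_Suc using \<tau>(1) by (rule bij_comp[rotated])
  qed
  define z where "z n = perm_act l (\<sigma> n) (x n)" for n
  have zM: "z n \<in> ?M" for n
    unfolding z_def using p(1) \<sigma> xM by (rule perm_act_mem_lp_ball)
  have z_step: "lp_bounded q l (2 * (1 / 2) ^ n) (\<lambda>i. z n i - z (Suc n) i)" for n
    using lp_bounded_perm_act_diff[OF \<sigma>[of n] \<tau>(2)[of n]]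
    by (simp add: z_def \<sigma>_Suc perm_act_comp[OF \<sigma> \<tau>(1)])
  \<comment> \<open>The geometric tail, reproduced by induction from
    \<open>2 * (1 / 2) ^ n + 4 * (1 / 2) ^ Suc n = 4 * (1 / 2) ^ n\<close>.\<close>
  have z_Suc: "lp_bounded q l (4 * (1 / 2) ^ n) (\<lambda>i. z n i - z (n + Suc k) i)" for n k
  proof (induction k arbitrary: n)
    case 0
    show ?case
      using lp_bounded_mono[OF q _ _ z_step[of n], of "4 * (1 / 2) ^ n"] by simp
  next
    case (Suc k)
    show ?case
      using lp_bounded_add[OF q _ _ z_step[of n] Suc[of "Suc n"]] by simp
  qed
  have z_diff: "lp_bounded q l (4 * (1 / 2) ^ n) (\<lambda>i. z n i - z m i)" if "n < m" for n m
    using z_Suc[of n "m - Suc n"] that by simp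
  have "convergent (\<lambda>n. z n i)" if i: "i \<in> tuples l" for i
  proof (intro Cauchy_convergent CauchyI')
    fix e :: real assume e: "0 < e"
    obtain N where N: "(1 / 2 :: real) ^ N < e / 4"
      using real_arch_pow_inv[of "e / 4" "1 / 2"] e by auto
    have "cmod (z m i - z n i) < e" if "N \<le> m" "m < n" for m n
    proof -
      have "cmod (z m i - z n i) \<le> 4 * (1 / 2) ^ m"
        using lp_bounded_pointwise[OF q _ z_diff[OF \<open>m < n\<close>] i] by simp
      moreover have "(1 / 2 :: real) ^ m \<le> (1 / 2) ^ N"
        using that by (intro power_decreasing) auto
      ultimately show ?thesis
        using N by linarith
    qed
    then show "\<exists>M. \<forall>m\<ge>M. \<forall>n>m. dist (z m i) (z n i) < e"
      unfolding dist_norm by blast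
  qed
  then have lim: "(\<lambda>n. z n i) \<longlonglongrightarrow> lim (\<lambda>n. z n i)" if "i \<in> tuples l" for i
    using that by (simp add: convergent_LIMSEQ_iff)
  define y where "y = (\<lambda>i\<in>tuples l. lim (\<lambda>n. z n i))"
  have y: "(\<lambda>n. z n i) \<longlonglongrightarrow> y i" if "i \<in> tuples l" for i
    using lim that by (simp add: y_def)
  \<comment> \<open>Convergence was obtained from \<open>q\<close>-bounds, but every
    \<open>z n\<close> lies in the \<open>p\<close>-ball, and pointwise limits preserve that
    bound.\<close>
  have "lp_bounded (ereal p) l 1 y"
    using p zM by (intro lp_bounded_limit[OF _ y]) (auto simp: lp_ball_iff)
  then have yM: "y \<in> ?M"
    using p by (simp add: lp_ball_iff y_def)
  have "orbit_dist q l y (x n) \<le> 4 * (1 / 2) ^ n" for n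
  proof (rule dense_ge)
    fix r :: real assume r: "4 * (1 / 2) ^ n < r"
    have "lp_bounded q l (4 * (1 / 2) ^ n) (\<lambda>i. z n i - y i)"
    proof (rule lp_bounded_limit[OF q])
      show "(\<lambda>m. z n i - z m i) \<longlonglongrightarrow> z n i - y i" if "i \<in> tuples l" for i
        by (intro tendsto_diff tendsto_const y that)
      show "lp_bounded q l (4 * (1 / 2) ^ n) (\<lambda>i. z n i - z m i)" if "Suc n \<le> m" for m
        using that by (intro z_diff) simp
    qed
    then have "lp_bounded q l (4 * (1 / 2) ^ n) (\<lambda>i. y i - perm_act l (\<sigma> n) (x n) i)"
      by (subst lp_bounded_minus_commute) (simp add: z_def)
    then have "orbit_dist q l y (x n) < r"
      unfolding orbit_dist_less_iff[OF p yM xM] using \<sigma> r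
      by (intro exI[of _ "\<sigma> n"] exI[of _ "4 * (1 / 2) ^ n"]) simp
    then show "orbit_dist q l y (x n) \<le> r" by simp
  qed
  then show ?thesis
    using yM by blast
qed

section \<open>Total boundedness\<close>

text \<open>Both complements are countably infinite, so a bijection between them extends an
  enumeration of \<open>A\<close>.\<close>

lemma bij_moving_into_initial_segment:
  fixes A :: "nat set"
  assumes "finite A"
  obtains \<tau> where "bij \<tau>" "\<tau> ` A = {..<card A}"
proof -
  have f: "bij_betw (to_nat_on A) A {..<card A}"
    using assms by (rule to_nat_on_finite)
  have inf: "infinite (- A)" "infinite (- {..<card A})"
    using assms by (simp_all del: Compl_lessThan)
  have "bij_betw (from_nat_into (- {..<card A}) \<circ> to_nat_on (- A)) (- A) (- {..<card A})"
    using inf by (intro bij_betw_trans[OF to_nat_on_infinite bij_betw_from_nat_into]) auto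
  from bij_betw_disjoint_Un[OF f this]
  have "bij_betw (\<lambda>i. if i \<in> A then to_nat_on A i else
      (from_nat_into (- {..<card A}) \<circ> to_nat_on (- A)) i) UNIV UNIV"
    by (simp del: Compl_lessThan)
  moreover have "(\<lambda>i. if i \<in> A then to_nat_on A i else
      (from_nat_into (- {..<card A}) \<circ> to_nat_on (- A)) i) ` A = {..<card A}"
    using f by (auto simp: bij_betw_def)
  ultimately show thesis
    using that by blast
qed

text \<open>An element of the unit ball has at most \<open>e\<^sup>-\<^sup>p\<close> entries of modulus greater than \<open>e\<close>, whose
  indices involve at most \<open>l e\<^sup>-\<^sup>p\<close> natural numbers.\<close>

lemma large_entries_movable:
  assumes p: "1 \<le> p" and e: "0 < e"
  obtains N where "\<And>x. x \<in> lp_ball (ereal p) l \<Longrightarrow> \<exists>\<tau>. bij \<tau> \<and>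
    (\<forall>i\<in>tuples l. \<not> set i \<subseteq> {..<N} \<longrightarrow> cmod (perm_act l \<tau> x i) \<le> e)"
proof
  define K where "K = nat \<lfloor>1 / e powr p\<rfloor>"
  fix x assume x: "x \<in> lp_ball (ereal p) l"
  define S where "S = {i \<in> tuples l. e < cmod (x i)}"
  \<comment> \<open>Markov's inequality: each index in \<open>G\<close> contributes at least
    \<open>e powr p\<close> to a sum of at most 1.\<close>
  have "card G \<le> K" if G: "finite G" "G \<subseteq> S" for G
  proof -
    have "real (card G) * e powr p = (\<Sum>i\<in>G. e powr p)"
      by simp
    also have "\<dots> \<le> (\<Sum>i\<in>G. cmod (x i) powr p)"
      using G e p by (intro sum_mono powr_mono2) (auto simp: S_def)
    also have "\<dots> \<le> 1"
      using x p G by (force simp: lp_ball_iff lp_bounded_ereal S_def)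
    finally show ?thesis
      using e by (simp add: K_def le_nat_iff le_floor_iff field_simps)
  qed
  then have S: "finite S" "card S \<le> K"
    using finite_if_finite_subsets_card_bdd[of S K] by auto
  define A where "A = (\<Union>i\<in>S. set i)"
  have "card A \<le> (\<Sum>i\<in>S. card (set i))"
    unfolding A_def using S by (intro card_UN_le)
  also have "\<dots> \<le> (\<Sum>i\<in>S. l)"
    by (intro sum_mono) (auto simp: S_def tuples_def intro: order_trans[OF card_length])
  also have "\<dots> \<le> K * l"
    using S by simp
  finally have A: "card A \<le> K * l" .
  have "finite A"
    using S by (simp add: A_def)
  then obtain \<tau> where \<tau>: "bij \<tau>" "\<tau> ` A = {..<card A}"
    by (rule bij_moving_into_initial_segment)
  have "cmod (perm_act l \<tau> x i) \<le> e" if i: "i \<in> tuples l" "\<not> set i \<subseteq> {..<K * l}" for i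
  proof (rule ccontr)
    assume "\<not> ?thesis"
    then have "map (inv \<tau>) i \<in> S"
      using i by (simp add: S_def perm_act_apply)
    then have "inv \<tau> ` set i \<subseteq> A"
      by (force simp: A_def)
    then have "\<tau> ` inv \<tau> ` set i \<subseteq> {..<card A}"
      using \<tau> by blast
    then have "set i \<subseteq> {..<card A}"
      using \<tau>(1) by (simp add: image_image bij_is_surj surj_f_inv_f)
    then show False
      using i A by auto
  qed
  then show "\<exists>\<tau>. bij \<tau> \<and> (\<forall>i\<in>tuples l. \<not> set i \<subseteq> {..<K * l} \<longrightarrow> cmod (perm_act l \<tau> x i) \<le> e)"
    using \<tau> by blast
qed

lemma floor_div_eq_imp_abs_diff_le:
  fixes a b e :: real
  assumes "0 < e" "\<lfloor>a / e\<rfloor> = \<lfloor>b / e\<rfloor>"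
  shows "\<bar>a - b\<bar> \<le> e"
proof -
  have "\<bar>a / e - b / e\<bar> \<le> 1"
    using assms(2) by linarith
  then show ?thesis
    using assms(1) by (simp add: field_simps abs_le_iff)
qed

lemma floor_div_mem:
  fixes a e :: real
  assumes "0 < e" "\<bar>a\<bar> \<le> 1"
  shows "\<lfloor>a / e\<rfloor> \<in> {\<lfloor>- 1 / e\<rfloor>..\<lfloor>1 / e\<rfloor>}"
proof -
  have "- 1 / e \<le> a / e" "a / e \<le> 1 / e"
    using assms by (intro divide_right_mono; simp)+
  then show ?thesis
    by (auto intro: floor_mono)
qed

lemma orbit_dist_finite_net:
  assumes p: "1 \<le> p" "ereal p < q" and d: "0 < d"
  shows "\<exists>C. finite C \<and> C \<subseteq> lp_ball (ereal p) l \<and>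
    (\<forall>x\<in>lp_ball (ereal p) l. \<exists>c\<in>C. orbit_dist q l c x < d)"
proof -
  let ?M = "lp_ball (ereal p) l"
  \<comment> \<open>The 2 bounds the \<open>p\<close>-norm of a difference of two elements of the
    ball; \<open>d / 2\<close> leaves room for a strict inequality.\<close>
  obtain \<eta> where \<eta>: "0 < \<eta>" and small: "\<And>u. \<lbrakk>lp_bounded (ereal p) l 2 u;
      \<And>i. i \<in> tuples l \<Longrightarrow> cmod (u i) \<le> \<eta>\<rbrakk> \<Longrightarrow> lp_bounded q l (d / 2) u"
    using lp_bounded_small[of p q "d / 2" 2 l] p d by auto
  \<comment> \<open>Two errors of size \<open>e\<close> add up: real and imaginary part inside the
    box, the two small entries outside.\<close>
  define e where "e = \<eta> / 2"
  have e: "0 < e"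
    using \<eta> by (simp add: e_def)
  obtain N where "\<And>x. x \<in> ?M \<Longrightarrow> \<exists>\<tau>. bij \<tau> \<and>
    (\<forall>i\<in>tuples l. \<not> set i \<subseteq> {..<N} \<longrightarrow> cmod (perm_act l \<tau> x i) \<le> e)"
    using large_entries_movable[OF p(1) e] by blast
  then obtain T where T: "\<And>x. x \<in> ?M \<Longrightarrow> bij (T x)"
    and far: "\<And>x i. \<lbrakk>x \<in> ?M; i \<in> tuples l; \<not> set i \<subseteq> {..<N}\<rbrakk> \<Longrightarrow> cmod (perm_act l (T x) x i) \<le> e"
    by metis
  define z where "z x = perm_act l (T x) x" for x
  have zM: "z x \<in> ?M" if "x \<in> ?M" for x
    unfolding z_def using p(1) T[OF that] that by (rule perm_act_mem_lp_ball)
  define F where "F = {i. set i \<subseteq> {..<N} \<and> length i = l}"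
  have F: "finite F"
    unfolding F_def by (rule finite_lists_length_eq) simp
  define \<phi> where "\<phi> x = (\<lambda>i\<in>F. (\<lfloor>Re (z x i) / e\<rfloor>, \<lfloor>Im (z x i) / e\<rfloor>))" for x
  have z1: "cmod (z x i) \<le> 1" if "x \<in> ?M" "i \<in> tuples l" for x i
    using zM[OF that(1)] that(2) p by (auto simp: lp_ball_iff intro: lp_bounded_pointwise[of "ereal p"])
  let ?J = "{\<lfloor>- 1 / e\<rfloor>..\<lfloor>1 / e\<rfloor>}"
  have "\<phi> x \<in> F \<rightarrow>\<^sub>E ?J \<times> ?J" if x: "x \<in> ?M" for x
  proof -
    have "\<bar>Re (z x i)\<bar> \<le> 1 \<and> \<bar>Im (z x i)\<bar> \<le> 1" if "i \<in> F" for i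
      using z1[OF x, of i] that abs_Re_le_cmod[of "z x i"] abs_Im_le_cmod[of "z x i"]
      by (auto simp: F_def tuples_def)
    then show ?thesis
      unfolding \<phi>_def restrict_PiE_iff using floor_div_mem[OF e] by blast
  qed
  then have "\<phi> ` ?M \<subseteq> F \<rightarrow>\<^sub>E ?J \<times> ?J"
    by blast
  moreover have "finite (F \<rightarrow>\<^sub>E ?J \<times> ?J)"
    using F by (intro finite_PiE) auto
  ultimately have fin: "finite (\<phi> ` ?M)"
    by (rule finite_subset)
  have close: "orbit_dist q l c x < d" if cx: "c \<in> ?M" "x \<in> ?M" "\<phi> c = \<phi> x" for c x
  proof -
    have "cmod (z c i - z x i) \<le> \<eta>" if i: "i \<in> tuples l" for i
    proof (cases "i \<in> F")
      case True
      then have "\<lfloor>Re (z c i) / e\<rfloor> = \<lfloor>Re (z x i) / e\<rfloor>" "\<lfloor>Im (z c i) / e\<rfloor> = \<lfloor>Im (z x i) / e\<rfloor>"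
        using fun_cong[OF cx(3), of i] by (auto simp: \<phi>_def)
      then have "\<bar>Re (z c i - z x i)\<bar> \<le> e" "\<bar>Im (z c i - z x i)\<bar> \<le> e"
        using floor_div_eq_imp_abs_diff_le[OF e] by auto
      then show ?thesis
        using cmod_le[of "z c i - z x i"] by (simp add: e_def)
    next
      case False
      then have "\<not> set i \<subseteq> {..<N}"
        using i by (simp add: F_def tuples_def)
      then have "cmod (z c i) \<le> e" "cmod (z x i) \<le> e"
        using far i cx by (auto simp: z_def)
      then show ?thesis
        using norm_triangle_ineq4[of "z c i" "z x i"] by (simp add: e_def)
    qed
    then have "lp_bounded q l (d / 2) (\<lambda>i. z c i - z x i)"
      using p zM cx by (intro small lp_ball_diff_lp_bounded[of p]) auto
    \<comment> \<open>Undoing the alignment of \<open>c\<close> turns closeness of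
      \<open>z c\<close> and \<open>z x\<close> into closeness of \<open>c\<close> and a permuted
      \<open>x\<close>.\<close>
    moreover have inv: "bij (inv (T c))" "inv (T c) \<circ> T c = id"
      using T[OF cx(1)] by (auto simp: bij_imp_bij_inv bij_is_inj)
    ultimately have "lp_bounded q l (d / 2)
        (\<lambda>i. perm_act l (inv (T c)) (z c) i - perm_act l (inv (T c)) (z x) i)"
      by (intro lp_bounded_perm_act_diff)
    moreover have "perm_act l (inv (T c)) (z c) = c"
      using inv T cx p by (simp add: z_def perm_act_comp perm_act_id lp_ball_iff)
    ultimately have "lp_bounded q l (d / 2) (\<lambda>i. c i - perm_act l (inv (T c) \<circ> T x) x i)"
      using inv T cx by (simp add: z_def perm_act_comp)
    moreover have "bij (inv (T c) \<circ> T x)"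
      using inv T cx by (simp add: bij_comp)
    ultimately show ?thesis
      unfolding orbit_dist_less_iff[OF p(1) less_imp_le[OF p(2)] cx(1,2)] using d
      by (intro exI[of _ "inv (T c) \<circ> T x"] exI[of _ "d / 2"]) simp
  qed
  \<comment> \<open>The net consists of one representative from each nonempty fibre of
    \<open>\<phi>\<close>.\<close>
  have "inv_into ?M \<phi> (\<phi> x) \<in> ?M \<and> \<phi> (inv_into ?M \<phi> (\<phi> x)) = \<phi> x" if "x \<in> ?M" for x
    using that by (simp add: inv_into_into f_inv_into_f)
  then show ?thesis
    using fin close by (intro exI[of _ "inv_into ?M \<phi> ` \<phi> ` ?M"]) blast
qed

theorem theorem5p1:
  fixes p :: real and q :: ereal and l :: nat
  assumes "1 \<le> p" and "1 < q" and "ereal p < q"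
  shows "pseudometric_space (lp_ball (ereal p) l) (orbit_dist q l) \<and>
         compact_space (pseudometric_topology (lp_ball (ereal p) l) (orbit_dist q l))"
proof
  have pq: "ereal p \<le> q"
    using assms(3) by simp
  show pm: "pseudometric_space (lp_ball (ereal p) l) (orbit_dist q l)"
    using assms(1) pq by (rule orbit_dist_pseudometric)
  show "compact_space (pseudometric_topology (lp_ball (ereal p) l) (orbit_dist q l))"
    using pm orbit_dist_finite_net[OF assms(1,3)] orbit_dist_complete[OF assms(1) pq]
    by (rule compact_space_pseudometric_topology)
qed

end
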